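(* Let $n\ge2$ be an integer. For $R\in(0,\sqrt{2(n-1)})$ let $u_R$ be the solution of $$\frac{u''}{1+(u')^2}=\frac{n-1}{u}-\frac u2+\frac x2u',\qquad u(0)=R,\quad u'(0)=0 .$$ Then, as $R\to0$, the vertical point $(b_R,u_R(b_R))$ of $u_R$ exists (i.e. it exists for all sufficiently small $R>0$), and $(b_R,u_R(b_R))\to(0,0)$.
   Context: The equation is that of profile curves $r=u(x)$ of rotationally symmetric self-shrinkers in $\mathbb R^{n+1}$ (rotation about the $x$-axis). A vertical point of $u_R$ is a point of its graph at which $|u_R'|=\infty$; here $b_R>0$ is such that $u_R$ is defined on $[0,b_R)$, $|u_R'(x)|\to\infty$ as $x\to b_R^-$, and $u_R(b_R)=\lim_{x\to b_R^-}u_R(x)$. *)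

theory Defs
  imports "HOL-Analysis.Analysis"
begin

text \<open>
  Solutions are required to be positive, so that the term \<open>(n - 1) / u\<close> is a genuine quotient.
  Derivatives are taken within \<open>I\<close>; for \<open>I = {0..<b}\<close> the ones at \<open>0\<close> are one-sided.  Since the
  equation is invariant under \<open>x \<mapsto> -x\<close> and \<open>u'(0) = 0\<close>, such a solution extends evenly to
  \<open>(-b, b)\<close>.
\<close>

definition profile_solution_on :: "nat \<Rightarrow> real \<Rightarrow> real set \<Rightarrow> (real \<Rightarrow> real) \<Rightarrow> bool" where
  "profile_solution_on n R I u \<longleftrightarrow>
     u 0 = R \<and>
     (\<exists>u' u''. u' 0 = 0 \<and>
       (\<forall>x\<in>I. u x > 0 \<and>
          (u has_real_derivative u' x) (at x within I) \<and>
          (u' has_real_derivative u'' x) (at x within I) \<and>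
          u'' x / (1 + (u' x)\<^sup>2) = (real n - 1) / u x - u x / 2 + x / 2 * u' x))"

text \<open>
  \<open>profile n R\<close> is the maximal solution \<open>u\<^sub>R\<close> to the right of \<open>0\<close>: its value at \<open>x \<ge> 0\<close> is the
  common value at \<open>x\<close> of all solutions on intervals \<open>{0..<b}\<close> containing \<open>x\<close>.  Elsewhere its
  value is irrelevant.
\<close>

definition profile :: "nat \<Rightarrow> real \<Rightarrow> real \<Rightarrow> real" where
  "profile n R x = (THE y. \<exists>b>x. \<exists>u. profile_solution_on n R {0..<b} u \<and> u x = y)"

definition is_vertical_point :: "nat \<Rightarrow> real \<Rightarrow> real \<times> real \<Rightarrow> bool" where
  "is_vertical_point n R p \<longleftrightarrow>
     (case p of (b, y) \<Rightarrow>
        0 < b \<and>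
        profile_solution_on n R {0..<b} (profile n R) \<and>
        filterlim (\<lambda>x. \<bar>deriv (profile n R) x\<bar>) at_top (at_left b) \<and>
        (profile n R \<longlongrightarrow> y) (at_left b))"

definition vertical_point :: "nat \<Rightarrow> real \<Rightarrow> real \<times> real" where
  "vertical_point n R = (THE p. is_vertical_point n R p)"

end

(*
  Parametrised by arclength, with tangent angle t, the profile curve solves the regular system
    x' = cos t,  r' = sin t,  t' = cos t ((n-1)/r - r/2) + x sin t / 2,
  and a vertical point is a point where t reaches pi/2.  As long as r <= 1 all three components
  are nondecreasing, x <= 2 r t, and x + r grows at least at unit speed; hence the curve must
  reach either height r = eps or angle pi/2 in bounded time, with x = O(eps).  For small R a
  logarithmic gain in x (the catenary effect) excludes that it reaches height eps first.
*)

theory Submission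
  imports Defs
begin

text \<open>Without the term x sin t / 2 the quantity r^(n-1) exp(-r^2/4) cos t would be conserved,
  so cos t would stay positive: a catenary-like curve becomes steep but never vertical. The turning
  therefore has to come from x sin t / 2 alone, and the obstacle is that x might be too small to
  achieve it. With that term the quantity, called \<open>w\<close> below, decreases at a rate
  proportional to x. Where the curve crosses height \<epsilon>/2, comparison with a catenary gives x
  >= w log(\<epsilon>/(2R)). If the curve went on to height \<epsilon>, it would lose at least c x
  of \<open>w\<close> on the way, with c depending on n and \<epsilon> only, while \<open>w\<close>
  stays nonnegative. So x >= c x log(\<epsilon>/(2R)) with x > 0, which fails for small R. Existence
  is obtained in arclength form, where the vector field can be truncated to a globally Lipschitz
  one. Uniqueness is needed in graph form, because \<open>profile\<close> is a definite description
  over all graph solutions.\<close>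

section \<open>Uniqueness of the profile and of its vertical point\<close>

lemma nondecreasing_within:
  fixes f f' :: "real \<Rightarrow> real"
  assumes "a \<le> b" "{a..b} \<subseteq> S"
    and der: "\<And>t. t \<in> {a..b} \<Longrightarrow> (f has_real_derivative f' t) (at t within S)"
    and nonneg: "\<And>t. a < t \<Longrightarrow> t < b \<Longrightarrow> 0 \<le> f' t"
  shows "f a \<le> f b"
proof (rule DERIV_nonneg_imp_increasing_open[OF \<open>a \<le> b\<close>])
  have der': "(f has_real_derivative f' t) (at t within {a..b})" if "t \<in> {a..b}" for t
    using der[OF that] assms(2) by (rule has_field_derivative_subset)
  show "continuous_on {a..b} f"
    using der' by (rule DERIV_continuous_on)
  fix t assume "a < t" "t < b"
  then show "\<exists>y. (f has_real_derivative y) (at t) \<and> 0 \<le> y"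
    using der'[of t] nonneg[of t] by (auto simp: at_within_Icc_at)
qed

text \<open>Gronwall argument: on the compact interval [0,x] the squared distance \<open>D\<close>
  of the two solutions in (value, slope) satisfies D' <= K D, so exp(-K t) D(t) is nonincreasing,
  and it starts at 0. Compactness is what bounds the coefficients, since slopes may blow up at the
  right ends of the domains.\<close>

lemma profile_solution_unique:
  assumes "profile_solution_on n R {0..<b} u" "profile_solution_on n R {0..<c} v"
    and "0 \<le> x" "x < b" "x < c"
  shows "u x = v x"
proof -
  define N where "N = real n - 1"
  define G where "G t y p = N / y - y / 2 + t / 2 * p" for t y p :: real
  obtain u' u'' where u: "u 0 = R" "u' 0 = 0" "\<And>t. t \<in> {0..<b} \<Longrightarrow> u t > 0"
    "\<And>t. t \<in> {0..<b} \<Longrightarrow> (u has_real_derivative u' t) (at t within {0..<b})"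
    "\<And>t. t \<in> {0..<b} \<Longrightarrow> (u' has_real_derivative u'' t) (at t within {0..<b})"
    "\<And>t. t \<in> {0..<b} \<Longrightarrow> u'' t / (1 + (u' t)\<^sup>2) = G t (u t) (u' t)"
    using assms(1) unfolding profile_solution_on_def G_def N_def by blast
  obtain v' v'' where v: "v 0 = R" "v' 0 = 0" "\<And>t. t \<in> {0..<c} \<Longrightarrow> v t > 0"
    "\<And>t. t \<in> {0..<c} \<Longrightarrow> (v has_real_derivative v' t) (at t within {0..<c})"
    "\<And>t. t \<in> {0..<c} \<Longrightarrow> (v' has_real_derivative v'' t) (at t within {0..<c})"
    "\<And>t. t \<in> {0..<c} \<Longrightarrow> v'' t / (1 + (v' t)\<^sup>2) = G t (v t) (v' t)"
    using assms(2) unfolding profile_solution_on_def G_def N_def by blast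
  let ?I = "{0..x}"
  have I: "?I \<subseteq> {0..<b}" "?I \<subseteq> {0..<c}"
    using assms by auto
  have du: "(u has_real_derivative u' t) (at t within ?I)" "(u' has_real_derivative u'' t) (at t within ?I)"
    and dv: "(v has_real_derivative v' t) (at t within ?I)" "(v' has_real_derivative v'' t) (at t within ?I)"
    if "t \<in> ?I" for t
    using has_field_derivative_subset[OF u(4)[OF subsetD[OF I(1) that]] I(1)]
      has_field_derivative_subset[OF u(5)[OF subsetD[OF I(1) that]] I(1)]
      has_field_derivative_subset[OF v(4)[OF subsetD[OF I(2) that]] I(2)]
      has_field_derivative_subset[OF v(5)[OF subsetD[OF I(2) that]] I(2)] by blast+
  have pos: "u t > 0" "v t > 0" if "t \<in> ?I" for t
    using that I u(3) v(3) by auto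
  note cont = DERIV_continuous_on[OF du(1)] DERIV_continuous_on[OF du(2)]
    DERIV_continuous_on[OF dv(1)] DERIV_continuous_on[OF dv(2)]
  \<comment> \<open>Coefficients of the linear equation for the difference: with a = u - v and d =
    u' - v' one gets u'' - v'' = (\<alpha> - 1) a + \<beta> d. The shift by 1 in \<alpha> absorbs
    the term 2 a d from differentiating a^2, so that D' = 2 \<alpha> a d + 2 \<beta> d^2.\<close>
  define \<alpha> where "\<alpha> t = 1 - (1 + (v' t)\<^sup>2) * (N / (u t * v t) + 1 / 2)" for t
  define \<beta> where "\<beta> t = (u' t + v' t) * G t (u t) (u' t) + (1 + (v' t)\<^sup>2) * (t / 2)" for t
  have "continuous_on ?I \<alpha>" "continuous_on ?I \<beta>"
    unfolding \<alpha>_def \<beta>_def G_def by (intro continuous_intros cont; use pos in force)+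
  then have "bounded (\<alpha> ` ?I)" "bounded (\<beta> ` ?I)"
    by (auto intro!: compact_imp_bounded compact_continuous_image)
  then obtain A B where AB: "\<And>t. t \<in> ?I \<Longrightarrow> \<bar>\<alpha> t\<bar> \<le> A" "\<And>t. t \<in> ?I \<Longrightarrow> \<bar>\<beta> t\<bar> \<le> B"
    unfolding bounded_iff by (metis imageI real_norm_def)
  define K where "K = A + 2 * B"
  define D where "D t = (u t - v t)\<^sup>2 + (u' t - v' t)\<^sup>2" for t
  define D' where "D' t = 2 * (u t - v t) * (u' t - v' t) + 2 * (u' t - v' t) * (u'' t - v'' t)" for t
  have D: "(D has_real_derivative D' t) (at t within ?I)" if "t \<in> ?I" for t
    unfolding D_def D'_def
    by (rule derivative_eq_intros refl du[OF that] dv[OF that])+ (simp add: algebra_simps)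
  have D'_le: "D' t \<le> K * D t" if t: "t \<in> ?I" for t
  proof -
    define a where "a = u t - v t"
    define d where "d = u' t - v' t"
    have "u'' t = (1 + (u' t)\<^sup>2) * G t (u t) (u' t)" "v'' t = (1 + (v' t)\<^sup>2) * G t (v t) (v' t)"
      using u(6)[of t] v(6)[of t] t I by (auto simp: divide_eq_eq add_nonneg_eq_0_iff mult.commute)
    moreover have "G t (v t) (v' t) = G t (u t) (u' t) + a * (N / (u t * v t) + 1 / 2) - d * (t / 2)"
      using pos[OF t] by (simp add: G_def a_def d_def field_simps)
    moreover define M h where "M = N / (u t * v t) + 1 / 2" and "h = t / 2"
    ultimately have "u'' t - v'' t = (1 + (u' t)\<^sup>2) * G t (u t) (u' t) - (1 + (v' t)\<^sup>2) * (G t (u t) (u' t) + a * M - d * h)"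
      by simp
    then have diff: "u'' t - v'' t = (\<alpha> t - 1) * a + \<beta> t * d"
      unfolding \<alpha>_def \<beta>_def M_def[symmetric] h_def[symmetric] d_def
      by (simp add: power2_eq_square algebra_simps)
    have "D' t = \<alpha> t * (2 * a * d) + 2 * \<beta> t * d\<^sup>2"
      unfolding D'_def diff a_def[symmetric] d_def[symmetric] by (simp add: power2_eq_square algebra_simps)
    also have "\<dots> \<le> A * (a\<^sup>2 + d\<^sup>2) + 2 * B * d\<^sup>2"
    proof (intro add_mono mult_right_mono)
      have "\<bar>2 * a * d\<bar> \<le> a\<^sup>2 + d\<^sup>2"
        using sum_squares_bound[of a d] sum_squares_bound[of "-a" d] by (simp add: abs_le_iff)
      then have "\<bar>\<alpha> t * (2 * a * d)\<bar> \<le> A * (a\<^sup>2 + d\<^sup>2)"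
        unfolding abs_mult[of "\<alpha> t"] using AB(1)[OF t] by (intro mult_mono) auto
      then show "\<alpha> t * (2 * a * d) \<le> A * (a\<^sup>2 + d\<^sup>2)" by simp
    qed (use AB(2)[OF t] in auto)
    also have "\<dots> \<le> A * (a\<^sup>2 + d\<^sup>2) + 2 * B * (a\<^sup>2 + d\<^sup>2)"
      using AB(2)[OF t] by (intro add_left_mono mult_left_mono) auto
    also have "\<dots> = K * D t"
      unfolding K_def D_def a_def d_def by (simp add: algebra_simps)
    finally show ?thesis .
  qed
  have "- (exp (- K * 0) * D 0) \<le> - (exp (- K * x) * D x)"
  proof (rule nondecreasing_within[OF \<open>0 \<le> x\<close> order_refl])
    fix t assume "t \<in> ?I"
    then show "((\<lambda>t. - (exp (- K * t) * D t)) has_real_derivative exp (- K * t) * (K * D t - D' t)) (at t within ?I)"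
      by (auto intro!: derivative_eq_intros D simp: algebra_simps)
  qed (use D'_le in auto)
  then have "D x \<le> 0"
    using u v by (simp add: D_def mult_le_0_iff)
  then show ?thesis
    by (simp add: D_def sum_power2_le_zero_iff)
qed

lemma profile_eq:
  assumes "profile_solution_on n R {0..<b} u" "0 \<le> x" "x < b"
  shows "profile n R x = u x"
  unfolding profile_def
proof (rule the_equality)
  show "\<exists>b>x. \<exists>w. profile_solution_on n R {0..<b} w \<and> w x = u x"
    using assms by blast
next
  fix y assume "\<exists>c>x. \<exists>v. profile_solution_on n R {0..<c} v \<and> v x = y"
  then obtain c v where "x < c" "profile_solution_on n R {0..<c} v" "v x = y" by blast
  then show "y = u x"
    using profile_solution_unique[OF assms(1) _ assms(2,3)] by metis
qed

lemma has_real_derivative_transform: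
  assumes "(f has_real_derivative d) (at x within S)" "x \<in> S" "\<And>y. y \<in> S \<Longrightarrow> g y = f y"
  shows "(g has_real_derivative d) (at x within S)"
  using has_derivative_transform[OF assms(2,3)] assms(1) by (simp add: has_field_derivative_def)

lemma profile_solution_on_cong:
  assumes "profile_solution_on n R I u" "0 \<in> I" and eq: "\<And>x. x \<in> I \<Longrightarrow> v x = u x"
  shows "profile_solution_on n R I v"
proof -
  obtain u' u'' where u: "u 0 = R" "u' 0 = 0" "\<And>x. x \<in> I \<Longrightarrow> u x > 0"
    "\<And>x. x \<in> I \<Longrightarrow> (u has_real_derivative u' x) (at x within I)"
    "\<And>x. x \<in> I \<Longrightarrow> (u' has_real_derivative u'' x) (at x within I)"
    "\<And>x. x \<in> I \<Longrightarrow> u'' x / (1 + (u' x)\<^sup>2) = (real n - 1) / u x - u x / 2 + x / 2 * u' x"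
    using assms(1) unfolding profile_solution_on_def by blast
  have "v 0 = R" "\<And>x. x \<in> I \<Longrightarrow> v x > 0"
    "\<And>x. x \<in> I \<Longrightarrow> u'' x / (1 + (u' x)\<^sup>2) = (real n - 1) / v x - v x / 2 + x / 2 * u' x"
    using u eq \<open>0 \<in> I\<close> by simp_all
  moreover have "\<And>x. x \<in> I \<Longrightarrow> (v has_real_derivative u' x) (at x within I)"
    using has_real_derivative_transform[OF u(4)] eq by blast
  ultimately show ?thesis
    unfolding profile_solution_on_def using u(2,5) by blast
qed

lemma has_real_derivative_at_interior:
  fixes f :: "real \<Rightarrow> real"
  assumes "(f has_real_derivative d) (at x within {a..<b})" "a < x" "x < b"
  shows "(f has_real_derivative d) (at x)"
proof -
  have "(f has_real_derivative d) (at x within {a<..<b})"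
    using assms(1) by (rule has_field_derivative_subset) auto
  then show ?thesis
    using assms at_within_open[of x "{a<..<b}"] by simp
qed

text \<open>If b < c, the profile would solve the equation across b, so its derivative would be
  continuous at b and have a finite limit there, against the blow-up.\<close>

lemma is_vertical_point_le:
  assumes p: "is_vertical_point n R (b, y)" and q: "is_vertical_point n R (c, z)"
  shows "c \<le> b"
proof (rule ccontr)
  assume "\<not> c \<le> b"
  then have bc: "0 < b" "b < c"
    using p by (auto simp: is_vertical_point_def)
  have "profile_solution_on n R {0..<c} (profile n R)"
    using q by (simp add: is_vertical_point_def)
  then obtain u' u'' where
    u': "\<And>t. t \<in> {0..<c} \<Longrightarrow> (profile n R has_real_derivative u' t) (at t within {0..<c})" and
    u'': "\<And>t. t \<in> {0..<c} \<Longrightarrow> (u' has_real_derivative u'' t) (at t within {0..<c})"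
    unfolding profile_solution_on_def by blast
  have "isCont u' b"
    using has_real_derivative_at_interior[OF u''] bc by (intro DERIV_isCont) auto
  then have "((\<lambda>x. \<bar>u' x\<bar>) \<longlongrightarrow> \<bar>u' b\<bar>) (at_left b)"
    by (intro tendsto_rabs) (simp add: isCont_def filterlim_at_split)
  moreover have "eventually (\<lambda>x. \<bar>u' x\<bar> = \<bar>deriv (profile n R) x\<bar>) (at_left b)"
    unfolding eventually_at_left[OF \<open>0 < b\<close>]
  proof (intro exI[of _ 0] conjI allI impI)
    fix t assume "0 < t" "t < b"
    then have "deriv (profile n R) t = u' t"
      using bc by (intro DERIV_imp_deriv has_real_derivative_at_interior[OF u']) auto
    then show "\<bar>u' t\<bar> = \<bar>deriv (profile n R) t\<bar>" by simp
  qed (use bc in simp)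
  ultimately have "((\<lambda>x. \<bar>deriv (profile n R) x\<bar>) \<longlongrightarrow> \<bar>u' b\<bar>) (at_left b)"
    by (rule Lim_transform_eventually)
  moreover have "filterlim (\<lambda>x. \<bar>deriv (profile n R) x\<bar>) at_infinity (at_left b)"
    using p by (auto simp: is_vertical_point_def intro: filterlim_at_top_imp_at_infinity)
  ultimately show False
    by (intro not_tendsto_and_filterlim_at_infinity[rotated]) auto
qed

lemma is_vertical_point_unique:
  assumes "is_vertical_point n R p" "is_vertical_point n R q"
  shows "p = q"
proof -
  obtain b y c z where [simp]: "p = (b, y)" "q = (c, z)"
    by (cases p, cases q)
  have [simp]: "b = c"
    using is_vertical_point_le[of n R b y c z] is_vertical_point_le[of n R c z b y] assms by simp
  have "y = z"
    by (rule tendsto_unique[of "at_left c" "profile n R"]) (use assms in \<open>auto simp: is_vertical_point_def\<close>)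
  then show ?thesis by simp
qed

section \<open>From an arclength curve to a graph with a vertical point\<close>

text \<open>Uniqueness makes \<open>profile n R\<close> agree with \<open>u\<close> on all of [0,b),
  so blow-up and limit may be checked on any explicitly constructed solution.\<close>

lemma is_vertical_pointI:
  assumes "0 < b" and u: "profile_solution_on n R {0..<b} u"
    and u': "\<And>x. x \<in> {0..<b} \<Longrightarrow> (u has_real_derivative u' x) (at x within {0..<b})"
    and lim: "filterlim (\<lambda>x. \<bar>u' x\<bar>) at_top (at_left b)" "(u \<longlongrightarrow> y) (at_left b)"
  shows "is_vertical_point n R (b, y)"
proof -
  have eq: "profile n R x = u x" if "x \<in> {0..<b}" for x
    using profile_eq[OF u] that by simp
  have der: "(profile n R has_real_derivative u' x) (at x within {0..<b})" if "x \<in> {0..<b}" for x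
    using has_real_derivative_transform[OF u'[OF that] that] eq by blast
  have deriv: "deriv (profile n R) x = u' x" if "0 < x" "x < b" for x
    by (rule DERIV_imp_deriv, rule has_real_derivative_at_interior[OF der that]) (use that in simp)
  have "eventually (\<lambda>x. \<bar>deriv (profile n R) x\<bar> = \<bar>u' x\<bar>) (at_left b)"
    unfolding eventually_at_left[OF \<open>0 < b\<close>] using \<open>0 < b\<close> deriv by (intro exI[of _ 0]) auto
  from filterlim_cong[OF refl refl this] lim(1)
  have "filterlim (\<lambda>x. \<bar>deriv (profile n R) x\<bar>) at_top (at_left b)" by simp
  moreover have "eventually (\<lambda>x. profile n R x = u x) (at_left b)"
    unfolding eventually_at_left[OF \<open>0 < b\<close>] using \<open>0 < b\<close> eq by (intro exI[of _ 0]) auto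
  from tendsto_cong[OF this] lim(2) have "(profile n R \<longlongrightarrow> y) (at_left b)" by simp
  moreover have "profile_solution_on n R {0..<b} (profile n R)"
    using \<open>0 < b\<close> by (intro profile_solution_on_cong[OF u] eq) auto
  ultimately show ?thesis
    using \<open>0 < b\<close> by (simp add: is_vertical_point_def)
qed

text \<open>Before time S the cosine is positive, so x is strictly increasing and the arc is the
  graph of u = r o g, where g inverts x. Its slope is tan \<theta>, which blows up exactly when
  \<theta> tends to pi/2.\<close>

lemma profile_arc_is_vertical_point:
  fixes x r \<theta> :: "real \<Rightarrow> real"
  assumes "0 < S" and init: "x 0 = 0" "r 0 = R" "\<theta> 0 = 0"
    and der: "\<And>s. s \<in> {0..S} \<Longrightarrow> (x has_real_derivative cos (\<theta> s)) (at s within {0..S})"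
      "\<And>s. s \<in> {0..S} \<Longrightarrow> (r has_real_derivative sin (\<theta> s)) (at s within {0..S})"
      "\<And>s. s \<in> {0..S} \<Longrightarrow>
        (\<theta> has_real_derivative cos (\<theta> s) * ((real n - 1) / r s - r s / 2) + x s * sin (\<theta> s) / 2) (at s within {0..S})"
    and pos: "\<And>s. s \<in> {0..S} \<Longrightarrow> 0 < r s"
    and \<theta>: "\<And>s. s \<in> {0..<S} \<Longrightarrow> \<theta> s \<in> {0..<pi/2}" "\<theta> S = pi / 2"
  shows "is_vertical_point n R (x S, r S)"
proof -
  define b where "b = x S"
  define \<theta>' where "\<theta>' s = cos (\<theta> s) * ((real n - 1) / r s - r s / 2) + x s * sin (\<theta> s) / 2" for s
  note der = der[folded \<theta>'_def]
  note cont = DERIV_continuous_on[OF der(1)] DERIV_continuous_on[OF der(2)] DERIV_continuous_on[OF der(3)]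
  have cos: "0 < cos (\<theta> s)" if "s \<in> {0..<S}" for s
    using \<theta>(1)[OF that] by (intro cos_gt_zero_pi) auto
  have less: "x s < x t" if "0 \<le> s" "s < t" "t \<le> S" for s t
  proof (rule DERIV_pos_imp_increasing_open[OF \<open>s < t\<close>])
    show "continuous_on {s..t} x"
      using cont(1) by (rule continuous_on_subset) (use that in auto)
    fix z assume "s < z" "z < t"
    then show "\<exists>y. (x has_real_derivative y) (at z) \<and> 0 < y"
      using der(1)[of z] cos[of z] that by (auto simp: at_within_Icc_at)
  qed
  have inj: "inj_on x {0..S}"
    using less by (force intro!: linorder_inj_onI)
  define g where "g = the_inv_into {0..S} x"
  have gx: "g (x s) = s" if "s \<in> {0..S}" for s
    using the_inv_into_f_f[OF inj that] by (simp add: g_def)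
  have "0 < b"
    using less[of 0 S] \<open>0 < S\<close> init by (simp add: b_def)
  have image: "\<exists>s\<in>{0..S}. x s = t" if "t \<in> {0..b}" for t
    using IVT'[of x 0 t S] that cont(1) \<open>0 < S\<close> init by (auto simp: b_def)
  have image_open: "x ` {0..<S} = {0..<b}"
  proof (intro set_eqI iffI)
    fix t assume "t \<in> x ` {0..<S}"
    then obtain s where "t = x s" "0 \<le> s" "s < S" by auto
    then show "t \<in> {0..<b}"
      using less[of 0 s] less[of s S] init by (cases "s = 0") (auto simp: b_def)
  next
    fix t assume t: "t \<in> {0..<b}"
    then obtain s where "s \<in> {0..S}" "x s = t" using image[of t] by auto
    with t show "t \<in> x ` {0..<S}" by (cases "s = S") (auto simp: b_def)
  qed
  have image_closed: "x ` {0..S} = {0..b}"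
  proof -
    have "{0..S} = insert S {0..<S}" "{0..b} = insert b {0..<b}"
      using \<open>0 < b\<close> \<open>0 < S\<close> by auto
    then show ?thesis
      using image_open by (simp add: b_def)
  qed
  \<comment> \<open>The inverse is continuous up to b by compactness, although its derivative 1 /
    cos \<theta> is infinite there. This yields both the differentiability on [0,b) and the limits
    at b.\<close>
  have contg: "continuous_on {0..b} g"
    using continuous_on_inv_into[OF cont(1) compact_Icc inj] by (simp add: image_closed g_def)
  have gI: "g t \<in> {0..<S}" "x (g t) = t" if "t \<in> {0..<b}" for t
    using that gx unfolding image_open[symmetric] by force+
  have derg: "(g has_real_derivative 1 / cos (\<theta> (g t))) (at t within {0..<b})" if t: "t \<in> {0..<b}" for t
  proof -
    have "(g has_derivative (*) (1 / cos (\<theta> (g t)))) (at (x (g t)) within x ` {0..<S})"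
    proof (rule has_derivative_inverse_within)
      show "(x has_derivative (*) (cos (\<theta> (g t)))) (at (g t) within {0..<S})"
        unfolding has_field_derivative_def[symmetric]
        by (rule has_field_derivative_subset[OF der(1)]) (use gI[OF t] in auto)
      show "continuous (at (x (g t)) within x ` {0..<S}) g"
        unfolding image_open gI(2)[OF t]
        by (rule continuous_within_subset[of _ "{0..b}"])
           (use contg t in \<open>auto simp: continuous_on_eq_continuous_within\<close>)
      show "(*) (1 / cos (\<theta> (g t))) \<circ> (*) (cos (\<theta> (g t))) = id"
        using cos[OF gI(1)[OF t]] by (auto simp: fun_eq_iff)
      show "linear ((*) (1 / cos (\<theta> (g t))))"
        by (intro bounded_linear.linear bounded_linear_mult_right)
    qed (use gI[OF t] gx in auto)
    then show ?thesis
      by (simp add: has_field_derivative_def image_open gI[OF t])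
  qed
  have chain: "((\<lambda>t. f (g t)) has_real_derivative d * (1 / cos (\<theta> (g t)))) (at t within {0..<b})"
    if f: "(f has_real_derivative d) (at (g t) within {0..S})" and t: "t \<in> {0..<b}" for f d t
  proof -
    have "(f has_real_derivative d) (at (g t) within g ` {0..<b})"
      using f by (rule has_field_derivative_subset) (use gI in force)
    from DERIV_image_chain[OF this derg[OF t]] show ?thesis by (simp add: o_def)
  qed
  define u where "u t = r (g t)" for t
  define u' where "u' t = tan (\<theta> (g t))" for t
  define u'' where "u'' t = \<theta>' (g t) / cos (\<theta> (g t)) ^ 3" for t
  have du: "(u has_real_derivative u' t) (at t within {0..<b})" if "t \<in> {0..<b}" for t
    using chain[OF der(2) that] gI[OF that] by (simp add: u_def[abs_def] u'_def tan_def)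
  have du': "(u' has_real_derivative u'' t) (at t within {0..<b})" if "t \<in> {0..<b}" for t
  proof -
    have "((\<lambda>s. tan (\<theta> s)) has_real_derivative \<theta>' (g t) * inverse ((cos (\<theta> (g t)))\<^sup>2)) (at (g t) within {0..S})"
      using gI[OF that] cos[OF gI(1)[OF that]]
      by (auto intro!: derivative_eq_intros der(3) simp: field_simps)
    from chain[OF this that] show ?thesis
      by (simp add: u'_def[abs_def] u''_def power3_eq_cube power2_eq_square field_simps)
  qed
  have u_pos: "0 < u t" if "t \<in> {0..<b}" for t
    using gI[OF that] pos by (simp add: u_def)
  have u_init: "u 0 = R" "u' 0 = 0"
    using gx[of 0] \<open>0 < S\<close> init by (simp_all add: u_def u'_def)
  have u_eq: "u'' t / (1 + (u' t)\<^sup>2) = (real n - 1) / u t - u t / 2 + t / 2 * u' t" if t: "t \<in> {0..<b}" for t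
  proof -
    have c: "cos (\<theta> (g t)) \<noteq> 0" using cos[OF gI(1)[OF t]] by simp
    \<comment> \<open>The factor sec^2 cancels two of the three cosines in \<open>u''\<close>;
      dividing the angle equation by the remaining one turns sin / cos into
      \<open>u'\<close>.\<close>
    have "1 + (u' t)\<^sup>2 = inverse (cos (\<theta> (g t)))^2"
      using tan_sec[OF c] by (simp add: u'_def)
    then have "u'' t / (1 + (u' t)\<^sup>2) = \<theta>' (g t) / cos (\<theta> (g t))"
      using c by (simp add: u''_def field_simps power2_eq_square power3_eq_cube)
    also have "\<dots> = (real n - 1) / u t - u t / 2 + t / 2 * u' t"
      using c gI[OF t] by (simp add: \<theta>'_def u_def u'_def tan_def add_divide_distrib)
    finally show ?thesis .
  qed
  have "profile_solution_on n R {0..<b} u"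
    unfolding profile_solution_on_def using u_pos u_init u_eq du du' by blast
  moreover have glim: "(g \<longlongrightarrow> S) (at_left b)"
    using contg \<open>0 < b\<close> gx[of S] \<open>0 < S\<close>
    by (auto simp: continuous_on_def b_def at_within_Icc_at_left dest!: bspec[of _ _ b])
  have ev: "eventually (\<lambda>t. t \<in> {0..<b}) (at_left b)"
    using eventually_at_left[OF \<open>0 < b\<close>] \<open>0 < b\<close> by (auto intro!: exI[of _ 0])
  have comp: "((\<lambda>t. f (g t)) \<longlongrightarrow> f S) (at_left b)" if f: "continuous_on {0..S} f" for f :: "real \<Rightarrow> real"
    by (rule continuous_on_tendsto_compose[OF f glim])
       (use \<open>0 < S\<close> ev gI in \<open>auto elim!: eventually_mono simp: less_imp_le\<close>)
  have "(u \<longlongrightarrow> r S) (at_left b)"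
    unfolding u_def[abs_def] by (rule comp[OF cont(2)])
  \<comment> \<open>The approach to pi/2 has to be strictly from below, since \<open>tan\<close>
    tends to +infinity only from that side.\<close>
  moreover have "filterlim (\<lambda>t. \<theta> (g t)) (at_left (pi / 2)) (at_left b)"
    unfolding filterlim_at
  proof
    show "eventually (\<lambda>t. \<theta> (g t) \<in> {..<pi / 2} \<and> \<theta> (g t) \<noteq> pi / 2) (at_left b)"
      using ev by (rule eventually_mono) (use gI \<theta> in force)
    show "((\<lambda>t. \<theta> (g t)) \<longlongrightarrow> pi / 2) (at_left b)"
      using comp[OF cont(3)] \<theta> by simp
  qed
  then have "filterlim u' at_top (at_left b)"
    unfolding u'_def[abs_def] by (rule filterlim_compose[OF filterlim_tan_at_left])
  then have "filterlim (\<lambda>t. \<bar>u' t\<bar>) at_top (at_left b)"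
    by (rule filterlim_at_top_mono) (intro always_eventually allI abs_ge_self)
  ultimately show ?thesis
    unfolding b_def[symmetric] using du \<open>0 < b\<close> by (intro is_vertical_pointI[of b n R u u']) auto
qed

section \<open>Global existence for Lipschitz fields and the truncated arclength system\<close>

text \<open>Weighting by exp(2 L t) makes the Picard operator contract by 1/2 on an interval of any
  length T, so no gluing of short-time solutions is needed. The iterates are partial sums of a
  telescoping series that converges uniformly by the Weierstrass M-test.\<close>

lemma picard_lindelof_lipschitz:
  fixes F :: "'a::banach \<Rightarrow> 'a"
  assumes lip: "L-lipschitz_on UNIV F" and "0 < L" and "0 \<le> T"
  obtains y where "y 0 = y0"
    and "\<And>t. t \<in> {0..T} \<Longrightarrow> (y has_vector_derivative F (y t)) (at t within {0..T})"
proof -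
  define \<phi> :: "nat \<Rightarrow> real \<Rightarrow> 'a" where "\<phi> k = rec_nat (\<lambda>_. y0) (\<lambda>_ g t. y0 + integral {0..t} (\<lambda>s. F (g s))) k" for k :: nat
  have \<phi>0: "\<phi> 0 = (\<lambda>_. y0)" and \<phi>Suc: "\<phi> (Suc k) = (\<lambda>t. y0 + integral {0..t} (\<lambda>s. F (\<phi> k s)))" for k
    by (simp_all add: \<phi>_def)
  have contF: "continuous_on UNIV F"
    using lip by (rule lipschitz_on_continuous_on)
  have contFg: "continuous_on {0..t} (\<lambda>s. F (g s))" if "continuous_on {0..T} g" "t \<le> T" for g t
    using continuous_on_compose2[OF contF continuous_on_subset[OF that(1)]] that(2) by auto
  have cont: "continuous_on {0..T} (\<phi> k)" for k
  proof (induction k)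
    case (Suc k)
    show ?case unfolding \<phi>Suc
      by (intro continuous_intros indefinite_integral_continuous_1 integrable_continuous_real contFg Suc order_refl)
  qed (simp add: \<phi>0)
  define M where "M = norm (F y0) * T"
  have step: "norm (\<phi> (Suc k) t - \<phi> k t) \<le> M * (1/2)^k * exp (2 * L * t)" if "t \<in> {0..T}" for k t
    using that
  proof (induction k arbitrary: t)
    case 0
    have "norm (\<phi> (Suc 0) t - \<phi> 0 t) = t * norm (F y0)"
      using 0 by (simp add: \<phi>Suc \<phi>0)
    also have "\<dots> \<le> M * 1"
      using 0 by (auto simp: M_def mult.commute[of _ T] intro!: mult_right_mono)
    also have "\<dots> \<le> M * exp (2 * L * t)"
      using 0 \<open>0 < L\<close> \<open>0 \<le> T\<close> by (intro mult_left_mono) (auto simp: M_def)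
    finally show ?case by simp
  next
    case (Suc k)
    have t: "0 \<le> t" "t \<le> T" using Suc.prems by auto
    have M0: "0 \<le> M" using \<open>0 \<le> T\<close> by (simp add: M_def)
    \<comment> \<open>Integrating L exp(2 L s) costs L / (2 L) = 1/2, which is the contraction
      factor.\<close>
    let ?g = "\<lambda>s. L * (M * (1/2)^k * exp (2 * L * s))"
    have g: "(?g has_integral (M * (1/2)^(Suc k) * exp (2 * L * t) - M * (1/2)^(Suc k) * exp (2 * L * 0))) {0..t}"
      using t \<open>0 < L\<close>
      by (intro fundamental_theorem_of_calculus)
         (auto intro!: derivative_eq_intros simp: has_real_derivative_iff_has_vector_derivative[symmetric])
    have int: "(\<lambda>s. F (\<phi> j s)) integrable_on {0..t}" for j
      by (intro integrable_continuous_real contFg cont t)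
    have "\<phi> (Suc (Suc k)) t - \<phi> (Suc k) t = integral {0..t} (\<lambda>s. F (\<phi> (Suc k) s) - F (\<phi> k s))"
      using int[of "Suc k"] int[of k] by (simp add: \<phi>Suc[of "Suc k"] \<phi>Suc[of k] Henstock_Kurzweil_Integration.integral_diff)
    also have "norm \<dots> \<le> integral {0..t} ?g"
    proof (rule Henstock_Kurzweil_Integration.integral_norm_bound_integral)
      fix s assume s: "s \<in> {0..t}"
      have "norm (F (\<phi> (Suc k) s) - F (\<phi> k s)) \<le> L * norm (\<phi> (Suc k) s - \<phi> k s)"
        using lipschitz_on_normD[OF lip] by simp
      also have "\<dots> \<le> ?g s"
        using s t \<open>0 < L\<close> by (intro mult_left_mono Suc.IH) auto
      finally show "norm (F (\<phi> (Suc k) s) - F (\<phi> k s)) \<le> ?g s" .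
    qed (use int g in \<open>auto intro!: Henstock_Kurzweil_Integration.integrable_diff\<close>)
    also have "\<dots> \<le> M * (1/2)^(Suc k) * exp (2 * L * t)"
      using integral_unique[OF g] M0 by simp
    finally show ?case .
  qed
  define y where "y t = y0 + (\<Sum>k. \<phi> (Suc k) t - \<phi> k t)" for t
  have "uniform_limit {0..T} (\<lambda>m t. \<Sum>k<m. \<phi> (Suc k) t - \<phi> k t) (\<lambda>t. \<Sum>k. \<phi> (Suc k) t - \<phi> k t) sequentially"
  proof (rule Weierstrass_m_test)
    fix k t assume t: "t \<in> {0..T}"
    have "norm (\<phi> (Suc k) t - \<phi> k t) \<le> M * (1/2)^k * exp (2 * L * t)" by (rule step[OF t])
    also have "\<dots> \<le> M * (1/2)^k * exp (2 * L * T)"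
      using t \<open>0 < L\<close> \<open>0 \<le> T\<close> by (intro mult_left_mono) (auto simp: M_def)
    finally show "norm (\<phi> (Suc k) t - \<phi> k t) \<le> M * (1/2)^k * exp (2 * L * T)" .
  qed (intro summable_mult summable_mult2 summable_geometric, simp)
  then have "uniform_limit {0..T} (\<lambda>m t. y0 + (\<Sum>k<m. \<phi> (Suc k) t - \<phi> k t)) y sequentially"
    unfolding y_def by (intro uniform_limit_intros)
  moreover have "(\<lambda>m t. y0 + (\<Sum>k<m. \<phi> (Suc k) t - \<phi> k t)) = \<phi>"
  proof (intro ext)
    fix m t show "y0 + (\<Sum>k<m. \<phi> (Suc k) t - \<phi> k t) = \<phi> m t"
      using sum_lessThan_telescope[of "\<lambda>k. \<phi> k t" m] by (simp add: \<phi>0)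
  qed
  ultimately have lim: "uniform_limit {0..T} \<phi> y sequentially" by simp
  have conty: "continuous_on {0..T} y"
    by (rule uniform_limit_theorem[OF _ lim]) (use cont in auto)
  have eq: "y t = y0 + integral {0..t} (\<lambda>s. F (y s))" if t: "t \<in> {0..T}" for t
  proof -
    have "uniform_limit {0..t} \<phi> y sequentially"
      using lim by (rule uniform_limit_on_subset) (use t in auto)
    then have "uniform_limit {0..t} (\<lambda>k s. F (\<phi> k s)) (\<lambda>s. F (y s)) sequentially"
      by (rule uniform_limit_compose_uniformly_continuous_on[OF _ lipschitz_on_uniformly_continuous[OF lip]]) auto
    then obtain I J where IJ: "\<And>k. ((\<lambda>s. F (\<phi> k s)) has_integral I k) {0..t}"
        "((\<lambda>s. F (y s)) has_integral J) {0..t}" "I \<longlonglongrightarrow> J"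
      by (rule uniform_limit_integral) (use t in \<open>auto intro!: contFg cont\<close>)
    have "I = (\<lambda>k. integral {0..t} (\<lambda>s. F (\<phi> k s)))" "J = integral {0..t} (\<lambda>s. F (y s))"
      using integral_unique[OF IJ(1)] integral_unique[OF IJ(2)] by auto
    then have "(\<lambda>k. \<phi> (Suc k) t) \<longlonglongrightarrow> y0 + integral {0..t} (\<lambda>s. F (y s))"
      unfolding \<phi>Suc using IJ(3) by (intro tendsto_intros) auto
    moreover have "(\<lambda>k. \<phi> (Suc k) t) \<longlonglongrightarrow> y t"
      using tendsto_uniform_limitI[OF lim t] by (rule LIMSEQ_Suc)
    ultimately show ?thesis by (rule LIMSEQ_unique[rotated])
  qed
  show thesis
  proof
    show "y 0 = y0" using eq[of 0] \<open>0 \<le> T\<close> by simp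
    fix t assume t: "t \<in> {0..T}"
    have "((\<lambda>t. y0 + integral {0..t} (\<lambda>s. F (y s))) has_vector_derivative F (y t)) (at t within {0..T})"
      using integral_has_vector_derivative[OF contFg[OF conty order_refl] t]
      by (auto intro!: derivative_eq_intros)
    then show "(y has_vector_derivative F (y t)) (at t within {0..T})"
      by (rule has_vector_derivative_transform[OF t, rotated]) (use eq in auto)
  qed
qed
text \<open>Meant for the two products in the angle equation. Lipschitz factors alone would not
  suffice; truncation supplies the bounds.\<close>

lemma lipschitz_on_mult_bounded:
  fixes f g :: "'a::metric_space \<Rightarrow> real"
  assumes f: "C-lipschitz_on X f" "\<And>x. x \<in> X \<Longrightarrow> \<bar>f x\<bar> \<le> A" "0 \<le> A"
    and g: "D-lipschitz_on X g" "\<And>x. x \<in> X \<Longrightarrow> \<bar>g x\<bar> \<le> B" "0 \<le> B"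
  shows "(A * D + B * C)-lipschitz_on X (\<lambda>x. f x * g x)"
proof (rule lipschitz_onI)
  show "0 \<le> A * D + B * C"
    using f(3) g(3) lipschitz_on_nonneg[OF f(1)] lipschitz_on_nonneg[OF g(1)] by simp
  fix x y assume X: "x \<in> X" "y \<in> X"
  have "f x * g x - f y * g y = f x * (g x - g y) + g y * (f x - f y)"
    by (simp add: algebra_simps)
  also have "\<bar>\<dots>\<bar> \<le> \<bar>f x\<bar> * \<bar>g x - g y\<bar> + \<bar>g y\<bar> * \<bar>f x - f y\<bar>"
    by (rule abs_triangle_ineq[THEN order_trans]) (simp add: abs_mult)
  also have "\<dots> \<le> A * (D * dist x y) + B * (C * dist x y)"
    using f(2)[OF X(1)] g(2)[OF X(2)] lipschitz_onD[OF f(1) X] lipschitz_onD[OF g(1) X] f(3) g(3)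
    by (intro add_mono mult_mono) (auto simp: dist_real_def)
  finally show "dist (f x * g x) (f y * g y) \<le> (A * D + B * C) * dist x y"
    by (simp add: dist_real_def algebra_simps)
qed

lemma clamp_real_mem:
  fixes a b y :: real
  assumes "a \<le> b"
  shows "clamp a b y \<in> {a..b}"
  using clamp_in_interval[of a b y] assms by simp

text \<open>The original field is singular at r = 0 and its term x sin \<theta> is not globally
  Lipschitz. Clamping each coordinate to a compact range cures both. The ranges are chosen so that
  the curve stays inside them as long as \<theta> <= pi/2 and r <= 1; for x this rests on x <= 2 r
  \<theta> <= pi < 4.\<close>

lemma profile_arc_clamped:
  fixes N R :: real
  assumes "0 < R" "R < 1" "0 \<le> T"
  defines "X \<equiv> clamp 0 (4::real)" and "Q \<equiv> clamp R (1::real)" and "\<Theta> \<equiv> clamp 0 (pi / 2)"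
  obtains x r \<theta> :: "real \<Rightarrow> real" where "x 0 = 0" "r 0 = R" "\<theta> 0 = 0"
    "\<And>s. s \<in> {0..T} \<Longrightarrow> (x has_real_derivative cos (\<Theta> (\<theta> s))) (at s within {0..T})"
    "\<And>s. s \<in> {0..T} \<Longrightarrow> (r has_real_derivative sin (\<Theta> (\<theta> s))) (at s within {0..T})"
    "\<And>s. s \<in> {0..T} \<Longrightarrow>
      (\<theta> has_real_derivative cos (\<Theta> (\<theta> s)) * (N / Q (r s) - Q (r s) / 2) + X (x s) * sin (\<Theta> (\<theta> s)) / 2) (at s within {0..T})"
proof -
  have X: "X y \<in> {0..4}" and Q: "Q y \<in> {R..1}" and \<Theta>: "\<Theta> y \<in> {0..pi/2}" for y
    unfolding X_def Q_def \<Theta>_def using \<open>R < 1\<close> by (intro clamp_real_mem; simp)+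
  have clamp_lip: "1-lipschitz_on UNIV (clamp a b)" for a b :: real
    by (rule lipschitz_onI) (auto intro: dist_clamps_le_dist_args)
  have proj_lip: "1-lipschitz_on UNIV (\<lambda>p::real \<times> real \<times> real. fst p)" "1-lipschitz_on UNIV (\<lambda>p::real \<times> real \<times> real. fst (snd p))"
    "1-lipschitz_on UNIV (\<lambda>p::real \<times> real \<times> real. snd (snd p))"
    by (rule lipschitz_onI; simp add: dist_fst_le order_trans[OF dist_fst_le dist_snd_le] order_trans[OF dist_snd_le dist_snd_le])+
  have sin_lip: "1-lipschitz_on A (sin :: real \<Rightarrow> real)" and cos_lip: "1-lipschitz_on A (cos :: real \<Rightarrow> real)" for A
  proof -
    have "1-lipschitz_on UNIV (sin :: real \<Rightarrow> real)"
      by (rule bounded_derivative_imp_lipschitz[where f' = "\<lambda>x h. cos x * h"])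
         (auto intro!: derivative_eq_intros onorm_le simp: abs_mult mult_left_le_one_le)
    then show "1-lipschitz_on A (sin :: real \<Rightarrow> real)" by (rule lipschitz_on_subset) simp
    have "1-lipschitz_on UNIV (cos :: real \<Rightarrow> real)"
      by (rule bounded_derivative_imp_lipschitz[where f' = "\<lambda>x h. - sin x * h"])
         (auto intro!: derivative_eq_intros onorm_le simp: abs_mult mult_left_le_one_le)
    then show "1-lipschitz_on A (cos :: real \<Rightarrow> real)" by (rule lipschitz_on_subset) simp
  qed
  have inv_lip: "(1 / R\<^sup>2)-lipschitz_on {R..} (\<lambda>y. 1 / y)"
  proof (rule lipschitz_onI)
    fix y z assume yz: "y \<in> {R..}" "z \<in> {R..}"
    have "\<bar>1 / y - 1 / z\<bar> = \<bar>y - z\<bar> / (y * z)"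
      using yz \<open>0 < R\<close> by (simp add: field_simps abs_divide abs_mult abs_minus_commute)
    also have "\<dots> \<le> \<bar>y - z\<bar> / R\<^sup>2"
      using yz \<open>0 < R\<close> by (intro divide_left_mono) (auto simp: power2_eq_square intro!: mult_mono)
    finally show "dist (1 / y) (1 / z) \<le> 1 / R\<^sup>2 * dist y z"
      by (simp add: dist_real_def)
  qed simp
  have comp: "C-lipschitz_on UNIV (\<lambda>p. f (g p))" if "C-lipschitz_on A f" "1-lipschitz_on UNIV g" "range g \<subseteq> A"
    for C and f :: "real \<Rightarrow> real" and g :: "real \<times> real \<times> real \<Rightarrow> real" and A
    using lipschitz_on_compose2[OF that(2) lipschitz_on_subset[OF that(1,3)]] by simp
  let ?x = "\<lambda>p::real \<times> real \<times> real. X (fst p)"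
    and ?r = "\<lambda>p::real \<times> real \<times> real. Q (fst (snd p))"
    and ?t = "\<lambda>p::real \<times> real \<times> real. \<Theta> (snd (snd p))"
  have lip: "1-lipschitz_on UNIV ?x" "1-lipschitz_on UNIV ?r" "1-lipschitz_on UNIV ?t"
    unfolding X_def Q_def \<Theta>_def
    by (intro comp[OF clamp_lip] proj_lip subset_UNIV)+
  have trig: "1-lipschitz_on UNIV (\<lambda>p. cos (?t p))" "1-lipschitz_on UNIV (\<lambda>p. sin (?t p))"
    by (rule comp[OF cos_lip lip(3)] comp[OF sin_lip lip(3)], rule subset_UNIV)+
  have inv: "(1 / R\<^sup>2)-lipschitz_on UNIV (\<lambda>p. 1 / ?r p)"
    by (rule comp[OF inv_lip lip(2)]) (use Q in auto)
  define h where "h p = N * (1 / ?r p) - 1 / 2 * ?r p" for p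
  have h_lip: "(\<bar>N\<bar> * (1 / R\<^sup>2) + \<bar>1 / 2\<bar> * 1)-lipschitz_on UNIV h"
    unfolding h_def by (intro lipschitz_on_diff lipschitz_on_cmult_real inv lip)
  have h_bound: "\<bar>h p\<bar> \<le> \<bar>N\<bar> * (1 / R) + 1 / 2" for p
  proof -
    have r: "R \<le> ?r p" "?r p \<le> 1" using Q by auto
    have "\<bar>h p\<bar> \<le> \<bar>N * (1 / ?r p)\<bar> + \<bar>1 / 2 * ?r p\<bar>"
      unfolding h_def by (rule abs_triangle_ineq4)
    also have "\<dots> \<le> \<bar>N\<bar> * (1 / R) + 1 / 2"
      unfolding abs_mult using r \<open>0 < R\<close> by (intro add_mono mult_left_mono) (auto simp: field_simps)
    finally show ?thesis .
  qed
  define F where "F p = (cos (?t p), sin (?t p), cos (?t p) * h p + 1 / 2 * (?x p * sin (?t p)))" for p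
  have "\<exists>C. C-lipschitz_on UNIV (\<lambda>p. cos (?t p) * h p)"
    by (rule exI, rule lipschitz_on_mult_bounded[OF trig(1) _ _ h_lip h_bound, where A = 1])
       (use \<open>0 < R\<close> in auto)
  moreover have "\<exists>C. C-lipschitz_on UNIV (\<lambda>p. ?x p * sin (?t p))"
    by (rule exI, rule lipschitz_on_mult_bounded[OF lip(1) _ _ trig(2), where A = 4 and B = 1])
       (use X in auto)
  ultimately obtain C D where "C-lipschitz_on UNIV (\<lambda>p. cos (?t p) * h p)"
      "D-lipschitz_on UNIV (\<lambda>p. ?x p * sin (?t p))"
    by blast
  note lipschitz_on_Pair[OF trig(1) lipschitz_on_Pair[OF trig(2) lipschitz_on_add[OF this(1)
        lipschitz_on_cmult_real[OF this(2)]]]]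
  then have "\<exists>L. L-lipschitz_on UNIV F"
    unfolding F_def by blast
  then obtain L where "L-lipschitz_on UNIV F" by blast
  \<comment> \<open>The existence lemma asks for a strictly positive constant, whereas L might be
    0.\<close>
  then have "(max 1 L)-lipschitz_on UNIV F" by (rule lipschitz_on_le) simp
  then obtain y where y: "y 0 = (0, R, 0)"
    "\<And>s. s \<in> {0..T} \<Longrightarrow> (y has_vector_derivative F (y s)) (at s within {0..T})"
    by (rule picard_lindelof_lipschitz[of "max 1 L" F T "(0, R, 0)"]) (use \<open>0 \<le> T\<close> in auto)
  show thesis
  proof (rule that[of "\<lambda>s. fst (y s)" "\<lambda>s. fst (snd (y s))" "\<lambda>s. snd (snd (y s))"])
    fix s assume s: "s \<in> {0..T}"
    have d1: "((\<lambda>s. fst (y s)) has_vector_derivative fst (F (y s))) (at s within {0..T})"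
      by (rule bounded_linear.has_vector_derivative[OF bounded_linear_fst y(2)[OF s]])
    have d2: "((\<lambda>s. snd (y s)) has_vector_derivative snd (F (y s))) (at s within {0..T})"
      by (rule bounded_linear.has_vector_derivative[OF bounded_linear_snd y(2)[OF s]])
    note d3 = bounded_linear.has_vector_derivative[OF bounded_linear_fst d2]
      and d4 = bounded_linear.has_vector_derivative[OF bounded_linear_snd d2]
    show "((\<lambda>s. fst (y s)) has_real_derivative cos (\<Theta> (snd (snd (y s))))) (at s within {0..T})"
      "((\<lambda>s. fst (snd (y s))) has_real_derivative sin (\<Theta> (snd (snd (y s))))) (at s within {0..T})"
      "((\<lambda>s. snd (snd (y s))) has_real_derivative cos (\<Theta> (snd (snd (y s)))) *
          (N / Q (fst (snd (y s))) - Q (fst (snd (y s))) / 2) + X (fst (y s)) * sin (\<Theta> (snd (snd (y s)))) / 2)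
        (at s within {0..T})"
      using d1 d3 d4 by (simp_all add: has_real_derivative_iff_has_vector_derivative F_def h_def)
  qed (simp_all add: y)
qed

section \<open>The logarithmic gain: height \<epsilon> is not reached\<close>

text \<open>Suppose height \<epsilon> is attained at S, and let S1 be a time at height \<epsilon>/2.
  The rise up to S1 forces x(S1) to be large compared with w(S1) (\<open>lower\<close>); the rise
  from S1 to S forces w(S1) to be large compared with x(S1) (\<open>upper\<close>). The second
  condition in \<open>small\<close> makes the two incompatible. Here \<mu> is the value of the
  weight \<nu> at height \<epsilon>/2.\<close>

lemma profile_arc_turns:
  fixes x r \<theta> :: "real \<Rightarrow> real"
  assumes "0 \<le> S" and init: "x 0 = 0" "r 0 = R" "\<theta> 0 = 0"
    and der: "\<And>s. s \<in> {0..S} \<Longrightarrow> (x has_real_derivative cos (\<theta> s)) (at s within {0..S})"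
      "\<And>s. s \<in> {0..S} \<Longrightarrow> (r has_real_derivative sin (\<theta> s)) (at s within {0..S})"
      "\<And>s. s \<in> {0..S} \<Longrightarrow>
        (\<theta> has_real_derivative cos (\<theta> s) * (N / r s - r s / 2) + x s * sin (\<theta> s) / 2) (at s within {0..S})"
    and \<theta>: "\<And>s. s \<in> {0..S} \<Longrightarrow> \<theta> s \<in> {0..pi/2}"
    and "1 \<le> N" "0 < R" "R < \<epsilon> / 2" "\<epsilon> \<le> 1"
    and \<mu>: "\<mu> = exp (N * ln (\<epsilon> / 2) - (\<epsilon> / 2)\<^sup>2 / 4)"
    and small: "R \<le> \<mu> / 2" "1 < \<mu> * \<epsilon> / 8 * ln (\<epsilon> / 2 / R)"
  shows "r S \<noteq> \<epsilon>"
proof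
  assume rS: "r S = \<epsilon>"
  have cos: "0 \<le> cos (\<theta> s)" and sin: "0 \<le> sin (\<theta> s)" if "s \<in> {0..S}" for s
    using \<theta>[OF that] pi_gt_zero by (auto intro!: cos_ge_zero sin_ge_zero simp del: pi_gt_zero)
  have r_mono: "r s \<le> r t" and x_mono: "x s \<le> x t" if "0 \<le> s" "s \<le> t" "t \<le> S" for s t
    using that by (auto intro!: nondecreasing_within[of s t "{0..S}", OF _ _ der(1)] cos
        nondecreasing_within[of s t "{0..S}", OF _ _ der(2)] sin)
  have r: "R \<le> r s" "r s \<le> \<epsilon>" and x: "0 \<le> x s" if "s \<in> {0..S}" for s
    using r_mono[of 0 s] r_mono[of s S] x_mono[of 0 s] that init rS by auto
  \<comment> \<open>An integrating factor: N / r - r / 2 is the logarithmic derivative of \<nu> with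
    respect to r, so in the derivative of \<nu> cos \<theta> everything cancels except the
    contribution of x sin \<theta> / 2.\<close>
  define \<nu> where "\<nu> s = exp (N * ln (r s) - (r s)\<^sup>2 / 4)" for s
  define w where "w s = \<nu> s * cos (\<theta> s)" for s
  have \<nu>_pos: "0 < \<nu> s" for s by (simp add: \<nu>_def)
  have d\<nu>: "(\<nu> has_real_derivative \<nu> s * (N / r s - r s / 2) * sin (\<theta> s)) (at s within {0..S})" if "s \<in> {0..S}" for s
    unfolding \<nu>_def using r[OF that] \<open>0 < R\<close>
    by (auto intro!: derivative_eq_intros der that simp: power2_eq_square field_simps)
  have dw: "(w has_real_derivative - (x s / 2 * \<nu> s * (sin (\<theta> s))\<^sup>2)) (at s within {0..S})" if "s \<in> {0..S}" for s
    unfolding w_def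
    by (rule derivative_eq_intros d\<nu> der that refl)+ (simp add: power2_eq_square algebra_simps)
  have \<nu>_mono: "\<nu> s \<le> \<nu> t" if "0 \<le> s" "s \<le> t" "t \<le> S" for s t
  proof (rule nondecreasing_within[OF \<open>s \<le> t\<close>, OF _ d\<nu>])
    fix z assume "s < z" "z < t"
    then have z: "z \<in> {0..S}" using that by auto
    have "r z \<le> 1" "0 < r z" using r[OF z] \<open>\<epsilon> \<le> 1\<close> \<open>0 < R\<close> by auto
    then have "r z / 2 \<le> 1" "1 \<le> N / r z" using \<open>1 \<le> N\<close> by auto
    then have "0 \<le> N / r z - r z / 2" by linarith
    then show "0 \<le> \<nu> z * (N / r z - r z / 2) * sin (\<theta> z)"
      by (intro mult_nonneg_nonneg sin[OF z] less_imp_le[OF \<nu>_pos])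
  qed (use that in auto)
  have w_mono: "w t \<le> w s" if "0 \<le> s" "s \<le> t" "t \<le> S" for s t
  proof -
    have "- w s \<le> - w t"
      by (rule nondecreasing_within[OF \<open>s \<le> t\<close> _ DERIV_minus[OF dw]])
         (use that x less_imp_le[OF \<nu>_pos] in auto)
    then show ?thesis by simp
  qed
  have w_nonneg: "0 \<le> w s" if "s \<in> {0..S}" for s
    using cos[OF that] \<nu>_pos[of s] by (simp add: w_def)
  have \<nu>_le: "\<nu> s \<le> r s" if "s \<in> {0..S}" for s
  proof -
    have "0 < r s" "r s \<le> 1" using r[OF that] \<open>0 < R\<close> \<open>\<epsilon> \<le> 1\<close> by auto
    then have "N * ln (r s) \<le> 1 * ln (r s)"
      using \<open>1 \<le> N\<close> by (intro mult_right_mono_neg) auto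
    then have "N * ln (r s) - (r s)\<^sup>2 / 4 \<le> ln (r s)"
      using zero_le_power2[of "r s"] by linarith
    then show ?thesis
      using \<open>0 < r s\<close> by (simp add: \<nu>_def ln_ge_iff)
  qed
  obtain S1 where S1: "S1 \<in> {0..S}" "r S1 = \<epsilon> / 2"
    using IVT'[of r 0 "\<epsilon> / 2" S] DERIV_continuous_on[OF der(2)] init rS \<open>R < \<epsilon> / 2\<close> \<open>0 < R\<close> \<open>0 \<le> S\<close> by auto
  then have "0 < S1" using init \<open>R < \<epsilon> / 2\<close> by (cases "S1 = 0") auto
  have \<nu>1: "\<nu> S1 = \<mu>" by (simp add: \<nu>_def S1 \<mu>)
  \<comment> \<open>Strict positivity is needed because the final contradiction is a strict
    inequality multiplied by x(S1). It comes from x'(0) = cos 0 = 1.\<close>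
  have x1_pos: "0 < x S1"
  proof -
    obtain d where d: "0 < d" "\<And>h. 0 < h \<Longrightarrow> 0 + h \<in> {0..S} \<Longrightarrow> h < d \<Longrightarrow> x 0 < x (0 + h)"
      using has_real_derivative_pos_inc_right[OF der(1)[of 0]] \<open>0 \<le> S\<close> init by auto
    have "0 < x (min (d / 2) S1)"
      using d(2)[of "min (d / 2) S1"] \<open>0 < d\<close> \<open>0 < S1\<close> S1 init by auto
    also have "\<dots> \<le> x S1"
      using \<open>0 < d\<close> \<open>0 < S1\<close> S1 by (intro x_mono) auto
    finally show ?thesis .
  qed
  \<comment> \<open>Up to S1 one has w(S1) sin \<theta> <= w <= r cos \<theta>, that is, x' >= w(S1)
    (ln r)'.\<close>
  have lower: "w S1 * ln (\<epsilon> / 2 / R) \<le> x S1"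
  proof -
    have "x 0 - w S1 * ln (r 0) \<le> x S1 - w S1 * ln (r S1)"
    proof (rule nondecreasing_within[where S = "{0..S}" and f = "\<lambda>s. x s - w S1 * ln (r s)"])
      fix s assume "s \<in> {0..S1}"
      then have s: "s \<in> {0..S}" using S1 by auto
      then show "((\<lambda>s. x s - w S1 * ln (r s)) has_real_derivative cos (\<theta> s) - w S1 * sin (\<theta> s) / r s) (at s within {0..S})"
        using r[OF s] \<open>0 < R\<close> by (auto intro!: derivative_eq_intros der)
    next
      fix s assume "0 < s" "s < S1"
      then have s: "s \<in> {0..S}" using S1 by auto
      have "w S1 * sin (\<theta> s) \<le> w S1 * 1"
        using w_nonneg[OF S1(1)] by (intro mult_left_mono) auto
      also have "\<dots> \<le> w s"
        using w_mono[of s S1] \<open>0 < s\<close> \<open>s < S1\<close> S1 by simp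
      also have "\<dots> \<le> r s * cos (\<theta> s)"
        unfolding w_def by (intro mult_right_mono \<nu>_le s cos)
      finally show "0 \<le> cos (\<theta> s) - w S1 * sin (\<theta> s) / r s"
        using r[OF s] \<open>0 < R\<close> by (simp add: field_simps)
    qed (use \<open>0 < S1\<close> S1 in auto)
    moreover have "ln (\<epsilon> / 2 / R) = ln (\<epsilon> / 2) - ln R"
      using \<open>0 < R\<close> \<open>R < \<epsilon> / 2\<close> using ln_div[of "\<epsilon> / 2" R] by simp
    ultimately show ?thesis
      by (simp only: init S1 right_diff_distrib)
  qed
  have upper: "\<mu> * \<epsilon> / 8 * x S1 \<le> w S1"
  proof -
    \<comment> \<open>On [S1,S] the loss rate of \<open>w\<close> is (x/2) \<nu> sin^2 \<theta> >=
      (x(S1)/2) \<mu> (1/2) sin \<theta> = k r'. As r gains \<epsilon>/2, the total loss is at least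
      k \<epsilon>/2, the left side of \<open>upper\<close>.\<close>
    define k where "k = x S1 * \<mu> / 4"
    have "- w S1 - k * r S1 \<le> - w S - k * r S"
    proof (rule nondecreasing_within[where S = "{0..S}" and f = "\<lambda>s. - w s - k * r s"])
      fix s assume "s \<in> {S1..S}"
      then have s: "s \<in> {0..S}" using S1 by auto
      show "((\<lambda>s. - w s - k * r s) has_real_derivative x s / 2 * \<nu> s * (sin (\<theta> s))\<^sup>2 - k * sin (\<theta> s)) (at s within {0..S})"
        by (auto intro!: derivative_eq_intros der s dw)
    next
      fix s assume "S1 < s" "s < S"
      then have s: "s \<in> {0..S}" using S1 by auto
      have \<nu>s: "\<mu> \<le> \<nu> s"
        using \<nu>_mono[of S1 s] \<open>S1 < s\<close> \<open>s < S\<close> S1 \<nu>1 by simp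
      \<comment> \<open>The initial value of \<open>w\<close> is at most R <= \<mu>/2, and \<nu> >=
        \<mu> after S1, so the curve is already steep there. The resulting bound sin^2 >= 3/4 is
        weakened to 1/4 to avoid a square root.\<close>
      have "\<nu> s * cos (\<theta> s) \<le> w 0"
        using w_mono[of 0 s] s by (simp add: w_def)
      also have "\<dots> \<le> R"
        using \<nu>_le[of 0] \<open>0 \<le> S\<close> init by (simp add: w_def)
      also have "\<dots> \<le> \<nu> s * (1 / 2)"
        using small \<nu>s by simp
      finally have "cos (\<theta> s) \<le> 1 / 2"
        using \<nu>_pos[of s] by (simp only: mult_le_cancel_left_pos)
      then have "(cos (\<theta> s))\<^sup>2 \<le> (1 / 2)\<^sup>2"
        using cos[OF s] by (intro power_mono)
      then have "(1 / 2)\<^sup>2 \<le> (sin (\<theta> s))\<^sup>2"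
        using sin_cos_squared_add[of "\<theta> s"] by (simp add: power2_eq_square)
      then have sin_ge: "1 / 2 \<le> sin (\<theta> s)"
        using sin[OF s] by (rule power2_le_imp_le)
      have "x S1 * \<mu> * (1 / 2) \<le> x s * \<nu> s * sin (\<theta> s)"
        using \<nu>s sin_ge x_mono[of S1 s] \<open>S1 < s\<close> s S1 x1_pos \<nu>_pos[of s] \<nu>_pos[of S1] \<nu>1
        by (intro mult_mono) auto
      then have "0 \<le> sin (\<theta> s) * (x s * \<nu> s * sin (\<theta> s) / 2 - k)"
        using sin[OF s] by (intro mult_nonneg_nonneg) (auto simp: k_def mult.commute)
      then show "0 \<le> x s / 2 * \<nu> s * (sin (\<theta> s))\<^sup>2 - k * sin (\<theta> s)"
        by (simp add: power2_eq_square algebra_simps)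
    qed (use S1 in auto)
    then show ?thesis
      using w_nonneg[of S] \<open>0 \<le> S\<close> by (simp add: S1 rS k_def algebra_simps)
  qed
  have "x S1 < \<mu> * \<epsilon> / 8 * ln (\<epsilon> / 2 / R) * x S1"
    using small x1_pos by simp
  also have "\<dots> = \<mu> * \<epsilon> / 8 * x S1 * ln (\<epsilon> / 2 / R)" by simp
  also have "\<dots> \<le> w S1 * ln (\<epsilon> / 2 / R)"
    using \<open>0 < R\<close> \<open>R < \<epsilon> / 2\<close> by (intro mult_right_mono upper) simp
  finally show False using lower by simp
qed

section \<open>Existence and location of the vertical point for small R\<close>

text \<open>The truncated arc is followed until \<theta> = pi/2 or r = \<epsilon>. Up to that time
  no clamp is active, so it is a genuine arc; the preceding lemma rules out the second event, and x
  <= 2 r \<theta> locates the first.\<close>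

lemma is_vertical_point_near_0:
  fixes n :: nat and R \<epsilon> \<mu> :: real
  assumes "2 \<le> n" "0 < R" "R < \<epsilon> / 2" "\<epsilon> \<le> 1"
    and \<mu>: "\<mu> = exp ((real n - 1) * ln (\<epsilon> / 2) - (\<epsilon> / 2)\<^sup>2 / 4)"
    and small: "R \<le> \<mu> / 2" "1 < \<mu> * \<epsilon> / 8 * ln (\<epsilon> / 2 / R)"
  obtains b y where "is_vertical_point n R (b, y)" "0 \<le> b" "b \<le> 4 * \<epsilon>" "0 \<le> y" "y \<le> \<epsilon>"
proof -
  define N where "N = real n - 1"
  have "1 \<le> N" using \<open>2 \<le> n\<close> by (simp add: N_def)
  have "R < 1" using assms by simp
  define X Q \<Theta> where "X = clamp 0 (4::real)" and "Q = clamp R (1::real)" and "\<Theta> = clamp 0 (pi / 2)"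
  have X: "X y \<in> {0..4}" and Q: "Q y \<in> {R..1}" and \<Theta>: "\<Theta> y \<in> {0..pi/2}" for y
    unfolding X_def Q_def \<Theta>_def using \<open>R < 1\<close> by (intro clamp_real_mem; simp)+
  have X_id: "X y = y" if "0 \<le> y" "y \<le> 4" for y
    unfolding X_def by (rule clamp_cancel_cbox) (use that in simp)
  have Q_id: "Q y = y" if "R \<le> y" "y \<le> 1" for y
    unfolding Q_def by (rule clamp_cancel_cbox) (use that in simp)
  have \<Theta>_id: "\<Theta> y = y" if "0 \<le> y" "y \<le> pi / 2" for y
    unfolding \<Theta>_def by (rule clamp_cancel_cbox) (use that in simp)
  define h where "h q = N / q - q / 2" for q
  obtain x r \<theta> :: "real \<Rightarrow> real" where init: "x 0 = 0" "r 0 = R" "\<theta> 0 = 0" and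
    der: "\<And>s. s \<in> {0..5} \<Longrightarrow> (x has_real_derivative cos (\<Theta> (\<theta> s))) (at s within {0..5})"
    "\<And>s. s \<in> {0..5} \<Longrightarrow> (r has_real_derivative sin (\<Theta> (\<theta> s))) (at s within {0..5})"
    "\<And>s. s \<in> {0..5} \<Longrightarrow>
      (\<theta> has_real_derivative cos (\<Theta> (\<theta> s)) * h (Q (r s)) + X (x s) * sin (\<Theta> (\<theta> s)) / 2) (at s within {0..5})"
    unfolding h_def X_def Q_def \<Theta>_def
    by (rule profile_arc_clamped[of R 5 N]) (use \<open>0 < R\<close> \<open>R < 1\<close> in auto)
  have cos: "0 \<le> cos (\<Theta> y)" and sin: "0 \<le> sin (\<Theta> y)" for y
    using \<Theta>[of y] pi_gt_zero by (auto intro!: cos_ge_zero sin_ge_zero simp del: pi_gt_zero)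
  \<comment> \<open>Used as: \<theta>' is at least cos \<theta> / (2 r) at heights up to 1, which is
    the source of the factor 2 in \<open>x_le\<close>.\<close>
  have h_ge: "1 \<le> 2 * q * h q" if "0 < q" "q \<le> 1" for q
  proof -
    have "q\<^sup>2 \<le> 1" using that by (simp add: power_le_one)
    moreover have "2 * q * h q = 2 * N - q\<^sup>2" using that by (simp add: h_def field_simps power2_eq_square)
    ultimately show ?thesis using \<open>1 \<le> N\<close> by simp
  qed
  have speed: "0 \<le> cos (\<Theta> (\<theta> s)) * h (Q (r s)) + X (x s) * sin (\<Theta> (\<theta> s)) / 2" for s
  proof -
    have "0 < Q (r s)" "Q (r s) \<le> 1" using Q[of "r s"] \<open>0 < R\<close> by auto
    then have "0 < 2 * Q (r s) * h (Q (r s))" using h_ge[of "Q (r s)"] by simp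
    then have "0 \<le> h (Q (r s))" using \<open>0 < Q (r s)\<close> by (simp add: zero_less_mult_iff)
    then show ?thesis using X[of "x s"] cos sin by simp
  qed
  have mono: "x s \<le> x t" "r s \<le> r t" "\<theta> s \<le> \<theta> t" if "0 \<le> s" "s \<le> t" "t \<le> 5" for s t
    by (rule nondecreasing_within[OF \<open>s \<le> t\<close> _ der(1)] nondecreasing_within[OF \<open>s \<le> t\<close> _ der(2)]
        nondecreasing_within[OF \<open>s \<le> t\<close> _ der(3)]; use that cos sin speed in auto)+
  have ge: "0 \<le> x s" "R \<le> r s" "0 \<le> \<theta> s" if "s \<in> {0..5}" for s
    using mono[of 0 s] that init by auto
  \<comment> \<open>Here only the clamps on \<theta> and r are known to be inactive. For
    \<open>X (x t)\<close> nonnegativity is enough, and the resulting bound on x is what later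
    removes the clamp on x, so there is no circularity.\<close>
  have x_le: "x s \<le> 2 * r s * \<theta> s"
    and s_le: "R + s \<le> x s + r s" if s: "s \<in> {0..5}" "\<theta> s \<le> pi / 2" "r s \<le> 1" for s
  proof -
    have id: "\<Theta> (\<theta> t) = \<theta> t" "Q (r t) = r t" if "0 \<le> t" "t \<le> s" for t
      using mono[of t s] ge[of t] that s by (auto intro!: \<Theta>_id Q_id)
    have "2 * r 0 * \<theta> 0 - x 0 \<le> 2 * r s * \<theta> s - x s"
    proof (rule nondecreasing_within[where S = "{0..5}" and f = "\<lambda>t. 2 * r t * \<theta> t - x t"])
      fix t assume "t \<in> {0..s}"
      then have t: "t \<in> {0..5}" using s by auto
      show "((\<lambda>t. 2 * r t * \<theta> t - x t) has_real_derivative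
          2 * sin (\<Theta> (\<theta> t)) * \<theta> t +
          2 * r t * (cos (\<Theta> (\<theta> t)) * h (Q (r t)) + X (x t) * sin (\<Theta> (\<theta> t)) / 2) - cos (\<Theta> (\<theta> t))) (at t within {0..5})"
        by (rule derivative_eq_intros der[OF t] refl)+ (simp add: algebra_simps)
    next
      fix t assume "0 < t" "t < s"
      then have t: "t \<in> {0..5}" "0 \<le> t" "t \<le> s" using s by auto
      have r: "0 < r t" "r t \<le> 1" using ge[OF t(1)] mono[of t s] \<open>0 < R\<close> t s by auto
      have "cos (\<theta> t) * 1 \<le> cos (\<theta> t) * (2 * r t * h (r t))"
        using cos[of "\<theta> t"] id[OF t(2,3)] by (intro mult_left_mono h_ge r) auto
      moreover have "0 \<le> 2 * sin (\<theta> t) * \<theta> t + r t * (X (x t) * sin (\<theta> t))"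
        using sin[of "\<theta> t"] id[OF t(2,3)] ge[OF t(1)] r X[of "x t"] by simp
      ultimately show "0 \<le> 2 * sin (\<Theta> (\<theta> t)) * \<theta> t +
          2 * r t * (cos (\<Theta> (\<theta> t)) * h (Q (r t)) + X (x t) * sin (\<Theta> (\<theta> t)) / 2) - cos (\<Theta> (\<theta> t))"
        unfolding id[OF t(2,3)] by (simp add: algebra_simps)
    qed (use s in auto)
    then show "x s \<le> 2 * r s * \<theta> s" using init by simp
    have "x 0 + r 0 - 0 \<le> x s + r s - s"
    proof (rule nondecreasing_within[where S = "{0..5}" and f = "\<lambda>t. x t + r t - t"])
      fix t assume "t \<in> {0..s}"
      then have t: "t \<in> {0..5}" using s by auto
      show "((\<lambda>t. x t + r t - t) has_real_derivative cos (\<Theta> (\<theta> t)) + sin (\<Theta> (\<theta> t)) - 1) (at t within {0..5})"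
        by (rule derivative_eq_intros der[OF t] refl)+
    next
      fix t
      define c d where "c = cos (\<Theta> (\<theta> t))" and "d = sin (\<Theta> (\<theta> t))"
      \<comment> \<open>In the first quadrant cos + sin >= cos^2 + sin^2 = 1.\<close>
      have "c\<^sup>2 \<le> c" "d\<^sup>2 \<le> d"
        using cos[of "\<theta> t"] sin[of "\<theta> t"] unfolding c_def d_def power2_eq_square
        by (auto intro!: mult_left_le)
      moreover have "d\<^sup>2 + c\<^sup>2 = 1" by (simp add: c_def d_def)
      ultimately show "0 \<le> cos (\<Theta> (\<theta> t)) + sin (\<Theta> (\<theta> t)) - 1"
        unfolding c_def[symmetric] d_def[symmetric] by linarith
    qed (use s in auto)
    then show "R + s \<le> x s + r s" using init by simp
  qed
  have unclamped:
    "(x has_real_derivative cos (\<theta> t)) (at t within {0..s})"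
    "(r has_real_derivative sin (\<theta> t)) (at t within {0..s})"
    "(\<theta> has_real_derivative cos (\<theta> t) * ((real n - 1) / r t - r t / 2) + x t * sin (\<theta> t) / 2) (at t within {0..s})"
    if s: "s \<in> {0..5}" "\<theta> s \<le> pi / 2" "r s \<le> 1" and t: "t \<in> {0..s}" for s t
  proof -
    have t': "t \<in> {0..5}" "\<theta> t \<le> pi / 2" "r t \<le> 1"
      using s t mono[of t s] by auto
    have "2 * r t * \<theta> t \<le> 2 * 1 * (pi / 2)"
      using t' ge[OF t'(1)] \<open>0 < R\<close> by (intro mult_mono) auto
    then have "x t \<le> 4" using x_le[OF t'] pi_less_4 by simp
    then have id: "\<Theta> (\<theta> t) = \<theta> t" "Q (r t) = r t" "X (x t) = x t"
      using t' ge[OF t'(1)] by (auto intro!: \<Theta>_id Q_id X_id)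
    have "{0..s} \<subseteq> {0..5}" using s by auto
    then show "(x has_real_derivative cos (\<theta> t)) (at t within {0..s})"
      "(r has_real_derivative sin (\<theta> t)) (at t within {0..s})"
      "(\<theta> has_real_derivative cos (\<theta> t) * ((real n - 1) / r t - r t / 2) + x t * sin (\<theta> t) / 2) (at t within {0..s})"
      using der[OF t'(1)] unfolding id h_def N_def by (blast intro: has_field_derivative_subset)+
  qed
  \<comment> \<open>\<open>m\<close> is negative while neither event has occurred; a zero of it is a
    time when one of the two holds with equality and the other bound is not exceeded.\<close>
  define m where "m s = max (\<theta> s - pi / 2) (r s - \<epsilon>)" for s
  have cont: "continuous_on {0..5} x" "continuous_on {0..5} r" "continuous_on {0..5} \<theta>"
    by (rule DERIV_continuous_on, erule der)+
  have "m 0 \<le> 0" using init assms by (simp add: m_def)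
  \<comment> \<open>This is where the length 5 comes from: otherwise x <= pi < 4 and r <= 1 at time
    5, against x + r >= R + 5.\<close>
  moreover have "0 \<le> m 5"
  proof (rule ccontr)
    assume "\<not> 0 \<le> m 5"
    then have m: "\<theta> 5 \<le> pi / 2" "r 5 \<le> 1" using \<open>\<epsilon> \<le> 1\<close> by (auto simp: m_def)
    have "2 * r 5 * \<theta> 5 \<le> 2 * 1 * (pi / 2)"
      using m ge[of 5] \<open>0 < R\<close> by (intro mult_mono) auto
    then show False
      using x_le[of 5] s_le[of 5] m \<open>0 < R\<close> pi_less_4 by simp
  qed
  moreover have "continuous_on {0..5} m"
    unfolding m_def by (intro continuous_intros cont)
  ultimately obtain s0 where s0: "s0 \<in> {0..5}" "m s0 = 0"
    using IVT'[of m 0 0 5] by auto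
  then have s0_le: "\<theta> s0 \<le> pi / 2" "r s0 \<le> \<epsilon>" and s0_eq: "\<theta> s0 = pi / 2 \<or> r s0 = \<epsilon>"
    by (auto simp: m_def max_def split: if_splits)
  have "r s0 \<noteq> \<epsilon>"
  proof (rule profile_arc_turns[where r = r and S = s0 and N = "real n - 1" and x = x and \<theta> = \<theta> and R = R and \<mu> = \<mu>])
    fix s assume s: "s \<in> {0..s0}"
    show "(x has_real_derivative cos (\<theta> s)) (at s within {0..s0})"
      "(r has_real_derivative sin (\<theta> s)) (at s within {0..s0})"
      "(\<theta> has_real_derivative cos (\<theta> s) * ((real n - 1) / r s - r s / 2) + x s * sin (\<theta> s) / 2) (at s within {0..s0})"
      using unclamped[OF s0(1) s0_le(1) _ s] s0_le \<open>\<epsilon> \<le> 1\<close> by auto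
    show "\<theta> s \<in> {0..pi/2}"
      using ge[of s] mono[of s s0] s s0 s0_le by auto
  qed (use s0 init assms \<open>1 \<le> N\<close> in \<open>auto simp: N_def\<close>)
  with s0_eq have \<theta>0: "\<theta> s0 = pi / 2" by simp
  \<comment> \<open>The graph lemma needs \<theta> < pi/2 strictly before the end. Since \<theta> is
    only known to be nondecreasing, \<open>s0\<close> need not be the first time at pi/2, so the
    least such time is taken.\<close>
  define A where "A = {0..s0} \<inter> \<theta> -` {pi / 2}"
  have "continuous_on {0..s0} \<theta>" using cont(3) by (rule continuous_on_subset) (use s0 in auto)
  then have "closed A" unfolding A_def by (intro continuous_closed_preimage) auto
  then have "compact A" using bounded_subset[of "{0..s0}" A] by (auto simp: compact_eq_bounded_closed A_def)
  moreover have "A \<noteq> {}" using \<theta>0 s0 by (auto simp: A_def)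
  ultimately obtain S where S: "S \<in> A" and S_min: "\<And>s. s \<in> A \<Longrightarrow> S \<le> s"
    using compact_attains_inf by metis
  have S5: "S \<in> {0..5}" and \<theta>S: "\<theta> S = pi / 2" and rS: "r S \<le> \<epsilon>"
    using S s0 s0_le mono[of S s0] by (auto simp: A_def)
  then have "0 < S" using init by (cases "S = 0") auto
  have xS: "x S \<le> 4 * \<epsilon>"
  proof -
    have "x S \<le> 2 * r S * \<theta> S" by (rule x_le[OF S5]) (use \<theta>S rS \<open>\<epsilon> \<le> 1\<close> in auto)
    also have "\<dots> = r S * pi" using \<theta>S by simp
    also have "\<dots> \<le> \<epsilon> * 4" using rS ge[OF S5] \<open>0 < R\<close> pi_less_4 by (intro mult_mono) auto
    finally show ?thesis by simp
  qed
  have "is_vertical_point n R (x S, r S)"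
  proof (rule profile_arc_is_vertical_point[where x = x and r = r and \<theta> = \<theta> and S = S])
    fix s assume s: "s \<in> {0..S}"
    show "(x has_real_derivative cos (\<theta> s)) (at s within {0..S})"
      "(r has_real_derivative sin (\<theta> s)) (at s within {0..S})"
      "(\<theta> has_real_derivative cos (\<theta> s) * ((real n - 1) / r s - r s / 2) + x s * sin (\<theta> s) / 2) (at s within {0..S})"
      using unclamped[OF S5 _ _ s] \<theta>S rS \<open>\<epsilon> \<le> 1\<close> by auto
    show "0 < r s" using ge[of s] s S5 \<open>0 < R\<close> by auto
  next
    fix s assume s: "s \<in> {0..<S}"
    then have "\<theta> s \<noteq> pi / 2" using S_min[of s] S by (auto simp: A_def)
    then show "\<theta> s \<in> {0..<pi/2}" using ge[of s] mono[of s S] s S5 \<theta>S by auto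
  qed (use \<open>0 < S\<close> init \<theta>S in auto)
  then show thesis
    using that xS rS ge[OF S5] \<open>0 < R\<close> by auto
qed

lemma is_vertical_point_small:
  fixes n :: nat and \<epsilon> :: real
  assumes "2 \<le> n" "0 < \<epsilon>" "\<epsilon> \<le> 1"
  shows "\<forall>\<^sub>F R in at_right 0. \<exists>b y. is_vertical_point n R (b, y) \<and> 0 \<le> b \<and> b \<le> 4 * \<epsilon> \<and> 0 \<le> y \<and> y \<le> \<epsilon>"
proof -
  define \<mu> where "\<mu> = exp ((real n - 1) * ln (\<epsilon> / 2) - (\<epsilon> / 2)\<^sup>2 / 4)"
  have "0 < \<mu>" by (simp add: \<mu>_def)
  \<comment> \<open>Solves \<mu> \<epsilon> / 8 * ln (\<epsilon> / 2 / R) = 1 for R; as \<mu>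
    depends only on n and \<epsilon>, this is a genuine threshold.\<close>
  define \<delta> where "\<delta> = \<epsilon> / 2 * exp (- (8 / (\<mu> * \<epsilon>)))"
  have "0 < \<delta>" using \<open>0 < \<epsilon>\<close> by (simp add: \<delta>_def)
  have "\<forall>\<^sub>F R in at_right 0. R \<in> {0<..<\<epsilon> / 2}" "\<forall>\<^sub>F R in at_right 0. R \<in> {0<..<\<mu> / 2}" "\<forall>\<^sub>F R in at_right 0. R \<in> {0<..<\<delta>}"
    using \<open>0 < \<epsilon>\<close> \<open>0 < \<mu>\<close> \<open>0 < \<delta>\<close> by (intro eventually_at_right_real; simp)+
  then show ?thesis
  proof eventually_elim
    case (elim R)
    then have R: "0 < R" "R < \<epsilon> / 2" "R \<le> \<mu> / 2" "R < \<delta>" by auto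
    have "8 / (\<mu> * \<epsilon>) < ln (\<epsilon> / 2 / R)"
    proof -
      have "R * exp (8 / (\<mu> * \<epsilon>)) < \<delta> * exp (8 / (\<mu> * \<epsilon>))" using R by simp
      also have "\<dots> = \<epsilon> / 2" by (simp add: \<delta>_def exp_minus)
      finally have "exp (8 / (\<mu> * \<epsilon>)) < \<epsilon> / 2 / R" using R by (simp add: field_simps)
      moreover have "0 < \<epsilon> / 2 / R" using R \<open>0 < \<epsilon>\<close> by simp
      ultimately show ?thesis by (metis exp_less_cancel_iff exp_ln)
    qed
    then have "1 < \<mu> * \<epsilon> / 8 * ln (\<epsilon> / 2 / R)"
      using \<open>0 < \<mu>\<close> \<open>0 < \<epsilon>\<close> by (simp add: pos_divide_less_eq mult.commute)
    then show ?case
      using is_vertical_point_near_0[OF \<open>2 \<le> n\<close> R(1,2) \<open>\<epsilon> \<le> 1\<close> \<mu>_def R(3)] by blast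
  qed
qed

theorem lemma8:
  fixes n :: nat
  assumes "n \<ge> 2"
  shows "(\<forall>\<^sub>F R in at 0 within {0<..<sqrt (2 * (real n - 1))}. \<exists>!p. is_vertical_point n R p) \<and>
         (vertical_point n \<longlongrightarrow> (0, 0)) (at 0 within {0<..<sqrt (2 * (real n - 1))})"
proof -
  have near_0: "\<forall>\<^sub>F R in at 0 within {0<..<sqrt (2 * (real n - 1))}.
      \<exists>b y. is_vertical_point n R (b, y) \<and> 0 \<le> b \<and> b \<le> 4 * \<epsilon> \<and> 0 \<le> y \<and> y \<le> \<epsilon>"
    if "0 < \<epsilon>" "\<epsilon> \<le> 1" for \<epsilon>
    by (rule filter_leD[OF _ is_vertical_point_small[OF assms that]]) (auto intro!: at_le)
  have "\<forall>\<^sub>F R in at 0 within {0<..<sqrt (2 * (real n - 1))}. \<exists>!p. is_vertical_point n R p"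
    by (rule eventually_mono[OF near_0[OF zero_less_one order_refl]]) (use is_vertical_point_unique in blast)+
  moreover have "(vertical_point n \<longlongrightarrow> (0, 0)) (at 0 within {0<..<sqrt (2 * (real n - 1))})"
  proof (rule tendstoI)
    fix e :: real assume "0 < e"
    \<comment> \<open>The distance to the origin is at most b + y <= 4 \<epsilon> + \<epsilon>, and
      5/6 of e leaves it strictly below e.\<close>
    define \<epsilon> where "\<epsilon> = min 1 (e / 6)"
    have \<epsilon>: "0 < \<epsilon>" "\<epsilon> \<le> 1" "5 * \<epsilon> < e" using \<open>0 < e\<close> by (auto simp: \<epsilon>_def min_def)
    show "\<forall>\<^sub>F R in at 0 within {0<..<sqrt (2 * (real n - 1))}. dist (vertical_point n R) (0, 0) < e"
      using near_0[OF \<epsilon>(1,2)]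
    proof eventually_elim
      case (elim R)
      then obtain b y where p: "is_vertical_point n R (b, y)" "0 \<le> b" "b \<le> 4 * \<epsilon>" "0 \<le> y" "y \<le> \<epsilon>"
        by blast
      have "vertical_point n R = (b, y)"
        unfolding vertical_point_def using p(1) is_vertical_point_unique by blast
      then have "dist (vertical_point n R) (0, 0) \<le> b + y"
        using sqrt_sum_squares_le_sum[OF p(2,4)] by (simp add: dist_Pair_Pair)
      then show ?case using p \<epsilon> by simp
    qed
  qed
  ultimately show ?thesis ..
qed

end
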